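(* Let $a,c>0$ and $b,d<0$ be real numbers, and let $W_0(z)=1$, $W_1(z)=z$, $W_n(z)=(az+b)W_{n-1}(z)+(cz+d)W_{n-2}(z)$ for $n\ge2$. Then every polynomial $W_n(z)$, $n\ge0$, is real-rooted if and only if $-b/a\le -d/c$.
   Context: A polynomial is real-rooted if all its zeros are real. *)

theory Defs
  imports "HOL-Computational_Algebra.Polynomial" Complex_Main
begin

definition real_rooted :: "real poly \<Rightarrow> bool" where
  "real_rooted p \<longleftrightarrow> (\<forall>z::complex. poly (map_poly complex_of_real p) z = 0 \<longrightarrow> z \<in> \<real>)"

fun W :: "real \<Rightarrow> real \<Rightarrow> real \<Rightarrow> real \<Rightarrow> nat \<Rightarrow> real poly" where
  "W a b c d 0 = 1"
| "W a b c d (Suc 0) = [:0, 1:]"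
| "W a b c d (Suc (Suc n)) = [:b, a:] * W a b c d (Suc n) + [:d, c:] * W a b c d n"

end

theory Submission
  imports Defs "HOL-Computational_Algebra.Fundamental_Theorem_Algebra"
begin

text \<open>
  Write \<open>\<alpha> = - b / a\<close> and \<open>\<beta> = - d / c\<close>.

  If \<open>\<alpha> \<le> \<beta>\<close>, fix a non-real \<open>z\<close> and consider the ratios \<open>R\<^sub>n = W\<^sub>n\<^sub>+\<^sub>1(z) / W\<^sub>n(z)\<close>, which satisfy
  \<open>R\<^sub>n\<^sub>+\<^sub>1 = (a z + b) + (c z + d) / R\<^sub>n\<close>. The two conditions that \<open>Im R\<^sub>n\<close> has the sign of
  \<open>Im z\<close> and that \<open>Im ((c z + d) / R\<^sub>n)\<close> does not have the opposite sign are preserved together,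
  so no \<open>W\<^sub>n(z)\<close> vanishes.

  If \<open>\<alpha> > \<beta>\<close>, the two characteristic roots at \<open>x = \<alpha>\<close> are opposite reals, and the larger of their
  moduli has a convex kink there. On the other hand, for all \<open>n\<close> of a suitable parity \<open>W\<^sub>n\<close> is
  positive on a fixed neighbourhood of \<open>\<alpha>\<close>, so real-rootedness would make \<open>log W\<^sub>n\<close> concave there.
  Comparing the growth rates of \<open>W\<^sub>n\<close> at \<open>\<alpha> - h\<close>, \<open>\<alpha>\<close>, \<open>\<alpha> + h\<close> gives a contradiction.
\<close>

section \<open>Real polynomials at complex points\<close>

lemma map_poly_of_real_add:
  "map_poly (of_real :: real \<Rightarrow> complex) (p + q) = map_poly of_real p + map_poly of_real q"
  by (rule poly_eqI) (simp add: coeff_map_poly)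

lemma map_poly_of_real_mult:
  "map_poly (of_real :: real \<Rightarrow> complex) (p * q) = map_poly of_real p * map_poly of_real q"
  by (rule poly_eqI) (simp add: coeff_map_poly coeff_mult)

lemma poly_map_of_real:
  "poly (map_poly of_real p) (of_real x :: complex) = of_real (poly p x)"
  by (induction p) (simp_all add: map_poly_pCons)

subsection \<open>Sufficiency\<close>

lemma Im_sign_inverse_le:
  fixes x :: complex
  assumes "s * Im x \<le> 0"
  shows "s * Im (1 / x) \<ge> 0"
proof -
  have "s * Im (1 / x) = - (s * Im x) / (cmod x)\<^sup>2"
    by (simp add: Im_divide cmod_power2)
  then show ?thesis
    using assms by (simp add: divide_nonpos_nonneg)
qed

lemma Im_sign_inverse_ge:
  fixes x :: complex
  assumes "s * Im x \<ge> 0"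
  shows "s * Im (1 / x) \<le> 0"
  using Im_sign_inverse_le[of "- s" x] assms by simp

text \<open>The determinant \<open>a * d - b * c\<close> is where the hypothesis enters: for
  positive \<open>a\<close> and \<open>c\<close>, \<alpha> \<le> \<beta> says that it is not
  positive.\<close>

lemma Im_moebius:
  fixes z :: complex
  shows "Im ((of_real a * z + of_real b) / (of_real c * z + of_real d)) =
    (a * d - b * c) * Im z / (cmod (of_real c * z + of_real d))\<^sup>2"
  by (simp add: Im_divide cmod_power2) (simp add: field_simps)

text \<open>Neither sign condition propagates alone: each one at \<open>Suc n\<close> rests on the
  other at \<open>n\<close>. The factor \<open>Im z\<close> treats both half-planes at once.\<close>

lemma poly_W_nonzero:
  fixes a b c d :: real and z :: complex
  defines "w \<equiv> \<lambda>n. poly (map_poly of_real (W a b c d n)) z"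
  assumes "a > 0" and "d < 0" and ad: "a * d \<le> b * c" and z: "Im z \<noteq> 0"
  shows "w n \<noteq> 0 \<and> Im z * Im (w (Suc n) / w n) > 0
    \<and> Im z * Im ((of_real c * z + of_real d) / (w (Suc n) / w n)) \<ge> 0"
proof (induction n)
  case 0
  have z0: "z \<noteq> 0" using z by auto
  have "(of_real c * z + of_real d) / z = of_real c + of_real d / z"
    using z0 by (simp add: field_simps)
  then have "Im z * Im ((of_real c * z + of_real d) / z) = - d * (Im z)\<^sup>2 / (cmod z)\<^sup>2"
    by (simp add: Im_divide cmod_power2) (simp add: power2_eq_square)
  also have "\<dots> \<ge> 0"
    using \<open>d < 0\<close> by (intro divide_nonneg_nonneg mult_nonneg_nonneg) auto
  finally show ?case
    using z by (auto simp: w_def map_poly_pCons zero_less_mult_iff)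
next
  case (Suc n)
  define R where "R = w (Suc n) / w n"
  define A where "A = of_real a * z + of_real b"
  define B where "B = of_real c * z + of_real d"
  define R' where "R' = w (Suc (Suc n)) / w (Suc n)"
  have R: "Im z * Im R > 0" and BR: "Im z * Im (B / R) \<ge> 0" and w0: "w n \<noteq> 0"
    using Suc by (simp_all add: R_def B_def)
  have R0: "R \<noteq> 0" using R by auto
  then have w1: "w (Suc n) \<noteq> 0" by (auto simp: R_def)
  have "w (Suc (Suc n)) = A * w (Suc n) + B * w n"
    by (simp add: w_def A_def B_def map_poly_of_real_add map_poly_of_real_mult map_poly_pCons
        algebra_simps del: mult_pCons_left)
  then have R'_eq: "R' = A + B / R"
    using w0 w1 by (simp add: R'_def R_def field_simps)
  have "Im z * Im R' = a * (Im z)\<^sup>2 + Im z * Im (B / R)"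
    by (simp add: R'_eq A_def algebra_simps power2_eq_square)
  moreover have "a * (Im z)\<^sup>2 > 0" using \<open>a > 0\<close> z by simp
  ultimately have 1: "Im z * Im R' > 0" using BR by linarith
  have 2: "Im z * Im (B / R') \<ge> 0"
  proof (cases "B = 0")
    case False
    \<comment> \<open>After division by \<open>B\<close>, neither summand has an imaginary part of
      the sign of \<open>Im z\<close>; inverting the sum reverses the sign.\<close>
    have "R' / B = A / B + 1 / R"
      using False R0 by (simp add: R'_eq field_simps)
    then have "Im z * Im (R' / B) = Im z * Im (A / B) + Im z * Im (1 / R)"
      by (simp add: algebra_simps)
    moreover have "Im z * Im (1 / R) \<le> 0"
      using R by (intro Im_sign_inverse_ge) simp
    moreover have "Im z * Im (A / B) = (a * d - b * c) * (Im z)\<^sup>2 / (cmod B)\<^sup>2"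
      unfolding A_def B_def Im_moebius by (simp add: power2_eq_square)
    then have "Im z * Im (A / B) \<le> 0"
      using ad by (simp add: divide_nonpos_nonneg mult_nonpos_nonneg)
    ultimately have "Im z * Im (1 / (R' / B)) \<ge> 0"
      by (intro Im_sign_inverse_le) linarith
    then show ?thesis by simp
  qed simp
  from w1 1 2 show ?case by (simp add: R'_def B_def)
qed

lemma real_rooted_W:
  assumes "a > 0" and "d < 0" and "a * d \<le> b * c"
  shows "real_rooted (W a b c d n)"
  unfolding real_rooted_def using poly_W_nonzero[OF assms] by (metis complex_is_Real_iff)

subsection \<open>Necessity\<close>

lemma real_rooted_factor:
  assumes "real_rooted p" and "degree p \<noteq> 0"
  obtains r q where "p = [:- r, 1:] * q" and "real_rooted q"
proof -
  let ?P = "map_poly complex_of_real p"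
  have "degree ?P = degree p" by (rule degree_map_poly) simp
  then have "\<not> constant (poly ?P)"
    using assms(2) by (simp add: constant_degree)
  then obtain z where z: "poly ?P z = 0"
    using fundamental_theorem_of_algebra by blast
  then have "z \<in> \<real>" using assms(1) by (simp add: real_rooted_def)
  then obtain r where "z = of_real r" by (auto elim: Reals_cases)
  with z have "poly p r = 0" by (simp add: poly_map_of_real)
  then obtain q where q: "p = [:- r, 1:] * q"
    by (auto simp: poly_eq_0_iff_dvd dvd_def)
  have "real_rooted q"
    using assms(1) unfolding real_rooted_def q map_poly_of_real_mult by simp
  with q show ?thesis by (rule that)
qed

text \<open>Between consecutive zeros \<open>log \<bar>p\<bar>\<close> is concave; this is its midpoint form.\<close>

lemma real_rooted_midpoint:
  assumes "real_rooted p" and "h \<ge> 0" and "\<And>x. m - h \<le> x \<Longrightarrow> x \<le> m + h \<Longrightarrow> poly p x \<noteq> 0"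
  shows "\<bar>poly p (m - h) * poly p (m + h)\<bar> \<le> (poly p m)\<^sup>2"
  using assms
proof (induction "degree p" arbitrary: p)
  case 0
  then obtain k where "p = [:k:]" by (metis degree_eq_zeroE)
  then show ?case by (simp add: power2_eq_square)
next
  case (Suc n)
  obtain r q where q: "p = [:- r, 1:] * q" and rr: "real_rooted q"
    using real_rooted_factor[OF Suc.prems(1)] Suc.hyps(2) by (metis nat.distinct(1))
  have "p \<noteq> 0" using Suc.hyps(2) by auto
  then have "q \<noteq> 0" using q by auto
  then have "degree q = n"
    using Suc.hyps(2) unfolding q by (subst (asm) degree_mult_eq) auto
  then have IH: "\<bar>poly q (m - h) * poly q (m + h)\<bar> \<le> (poly q m)\<^sup>2"
    using Suc.prems rr by (intro Suc.hyps(1)) (auto simp: q)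
  have "poly p r = 0" by (simp add: q)
  then have "r < m - h \<or> r > m + h" using Suc.prems(3)[of r] by linarith
  \<comment> \<open>Since \<open>r\<close> lies outside the interval, its factor contributes
    \<open>(m - r)^2 - h^2\<close> in absolute value, at most the square of its value at the
    midpoint.\<close>
  then have "(m - h - r) * (m + h - r) > 0"
    using \<open>h \<ge> 0\<close> by (auto intro: mult_pos_pos mult_neg_neg)
  then have "\<bar>(m - h - r) * (m + h - r)\<bar> = (m - h - r) * (m + h - r)"
    by simp
  also have "\<dots> = (m - r)\<^sup>2 - h\<^sup>2"
    by (simp add: power2_eq_square algebra_simps)
  also have "\<dots> \<le> (m - r)\<^sup>2" by simp
  finally have "\<bar>(m - h - r) * (m + h - r)\<bar> * \<bar>poly q (m - h) * poly q (m + h)\<bar> \<le>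
      (m - r)\<^sup>2 * (poly q m)\<^sup>2"
    using IH by (intro mult_mono) auto
  moreover have "poly p x = (x - r) * poly q x" for x by (simp add: q algebra_simps)
  ultimately show ?case
    by (simp only: abs_mult power_mult_distrib mult_ac)
qed

section \<open>Characteristic roots and growth at real points\<close>

lemma poly_W_rec:
  "poly (W a b c d (Suc (Suc n))) x =
    (a * x + b) * poly (W a b c d (Suc n)) x + (c * x + d) * poly (W a b c d n) x"
  by (simp add: algebra_simps)

text \<open>Binet's formula: \<open>l\<close> and \<open>- m\<close> are the characteristic roots at
  \<open>x\<close>. The factor \<open>l + m\<close> avoids a division.\<close>

lemma W_binet:
  fixes x :: real
  assumes "l - m = a * x + b" and "l * m = c * x + d"
  shows "(l + m) * poly (W a b c d n) x = (x + m) * l ^ n + (l - x) * (- m) ^ n"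
  using assms
proof (induction a b c d n rule: W.induct)
  case (3 a b c d n)
  let ?w = "\<lambda>k. poly (W a b c d k) x"
  have "(l + m) * ?w (Suc (Suc n)) = (l - m) * ((l + m) * ?w (Suc n)) + l * m * ((l + m) * ?w n)"
    unfolding poly_W_rec 3(3,4)[symmetric] by (simp only: algebra_simps)
  also have "\<dots> = (l - m) * ((x + m) * l ^ Suc n + (l - x) * (- m) ^ Suc n)
      + l * m * ((x + m) * l ^ n + (l - x) * (- m) ^ n)"
    using 3 by simp
  also have "\<dots> = (x + m) * l ^ Suc (Suc n) + (l - x) * (- m) ^ Suc (Suc n)"
    by (simp add: algebra_simps)
  finally show ?case .
qed (simp_all add: algebra_simps)

text \<open>The quadratic in \<open>sign\<close> is \<open>(x - l) * (x + m)\<close>, so it has the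
  sign of \<open>x - l\<close>; for the right parity the two terms of Binet's formula are positive
  and cannot cancel. The bound keeps \<open>m ^ n\<close>, which dominates where
  \<open>a * x + b < 0\<close>.\<close>

lemma W_lower_parity:
  fixes x :: real
  assumes "l - m = a * x + b" and "l * m = c * x + d"
    and "l > 0" and "m > 0" and "x > 0"
    and sign: "(- 1) ^ n * (x\<^sup>2 - (a * x + b) * x - (c * x + d)) < 0"
  shows "(l + m) * poly (W a b c d n) x \<ge> \<bar>x - l\<bar> * m ^ n"
    and "poly (W a b c d n) x > 0"
    and "x \<noteq> l"
proof -
  have "x\<^sup>2 - (a * x + b) * x - (c * x + d) = (x - l) * (x + m)"
    unfolding assms(1,2)[symmetric] by (simp add: power2_eq_square algebra_simps)
  then have "(- 1) ^ n * (x - l) * (x + m) < 0" using sign by (simp add: mult.assoc)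
  then have neg: "(- 1) ^ n * (x - l) < 0"
    using \<open>m > 0\<close> \<open>x > 0\<close> by (simp add: mult_less_0_iff)
  then show "x \<noteq> l" by auto
  have "\<bar>x - l\<bar> = \<bar>(- 1) ^ n * (x - l)\<bar>" by (simp add: abs_mult)
  with neg have "\<bar>x - l\<bar> = - ((- 1) ^ n * (x - l))" by linarith
  moreover have "(l - x) * (- m) ^ n = - ((- 1) ^ n * (x - l)) * m ^ n"
    by (simp add: power_minus[of m] algebra_simps)
  ultimately have "(l - x) * (- m) ^ n = \<bar>x - l\<bar> * m ^ n" by simp
  then have eq: "(l + m) * poly (W a b c d n) x = (x + m) * l ^ n + \<bar>x - l\<bar> * m ^ n"
    using W_binet[OF assms(1,2)] by simp
  have pos: "(x + m) * l ^ n > 0" using assms by simp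
  then show "(l + m) * poly (W a b c d n) x \<ge> \<bar>x - l\<bar> * m ^ n" using eq by linarith
  have "\<bar>x - l\<bar> * m ^ n \<ge> 0" using \<open>m > 0\<close> by simp
  then have "(l + m) * poly (W a b c d n) x > 0" using eq pos by linarith
  then show "poly (W a b c d n) x > 0" using assms by (simp add: zero_less_mult_iff)
qed

lemma char_roots_exist:
  fixes A B :: real
  assumes "B > 0"
  obtains l m where "l > 0" "m > 0" "l - m = A" "l * m = B"
proof
  let ?s = "sqrt (A\<^sup>2 + 4 * B)"
  have s2: "?s\<^sup>2 = A\<^sup>2 + 4 * B" using assms by simp
  have "?s > sqrt (A\<^sup>2)" using assms by (intro real_sqrt_less_mono) simp
  then have "?s > \<bar>A\<bar>" by simp
  then show "(?s + A) / 2 > 0" and "(?s - A) / 2 > 0" by auto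
  show "(?s + A) / 2 - (?s - A) / 2 = A" by (simp add: field_simps)
  have "(?s + A) / 2 * ((?s - A) / 2) = (?s\<^sup>2 - A\<^sup>2) / 4"
    by (simp add: power2_eq_square algebra_simps)
  then show "(?s + A) / 2 * ((?s - A) / 2) = B" using s2 by simp
qed

text \<open>Nonnegative coefficients make the recursion monotone, and \<open>K * l ^ n\<close>
  solves it exactly; the bounds on \<open>K\<close> compare the two initial values.\<close>

lemma W_lower_pos:
  fixes x :: real
  assumes "a * x + b \<ge> 0" and "c * x + d \<ge> 0" and "l > 0"
    and "l\<^sup>2 = (a * x + b) * l + (c * x + d)" and "K \<le> 1" and "K * l \<le> x"
  shows "poly (W a b c d n) x \<ge> K * l ^ n"
  using assms
proof (induction a b c d n rule: W.induct)
  case (3 a b c d n)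
  have "K * l ^ Suc (Suc n) = K * l ^ n * l\<^sup>2"
    by (simp add: power2_eq_square)
  also have "\<dots> = (a * x + b) * (K * l ^ Suc n) + (c * x + d) * (K * l ^ n)"
    unfolding 3(6) by (simp add: algebra_simps)
  also have "\<dots> \<le> poly (W a b c d (Suc (Suc n))) x"
    unfolding poly_W_rec using 3 by (intro add_mono mult_left_mono) auto
  finally show ?case .
qed simp_all

text \<open>Here the recursion only multiplies by \<open>c * x + d\<close> every two steps. Squaring
  gives one bound for both parities, with a constant covering both initial values.\<close>

lemma W_square_at_zero:
  fixes x :: real
  assumes "a * x + b = 0" and "c * x + d > 0"
  shows "(poly (W a b c d n) x)\<^sup>2 \<le> (1 + x\<^sup>2 / (c * x + d)) * (c * x + d) ^ n"
  using assms
proof (induction a b c d n rule: W.induct)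
  case (3 a b c d n)
  let ?B = "c * x + d"
  have "(poly (W a b c d (Suc (Suc n))) x)\<^sup>2 = ?B\<^sup>2 * (poly (W a b c d n) x)\<^sup>2"
    unfolding poly_W_rec using 3(3) by (simp add: power_mult_distrib)
  also have "\<dots> \<le> ?B\<^sup>2 * ((1 + x\<^sup>2 / ?B) * ?B ^ n)"
    using 3 by (intro mult_left_mono) auto
  finally show ?case by (simp add: power2_eq_square mult_ac)
qed (simp_all add: power2_eq_square distrib_right)

lemma char_root_product:
  fixes a c h B l m :: real
  assumes "m\<^sup>2 = a * h * m + (B - c * h)" and "l\<^sup>2 = a * h * l + (B + c * h)"
    and pos: "a > 0" "c > 0" "h > 0" "B > 0" "l > 0" "m > 0"
    and h1: "2 * (c * h) \<le> B" and h2: "2 * c\<^sup>2 * h < a * sqrt B * B"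
  shows "l * m > B"
proof -
  have "l\<^sup>2 > B" using assms by (simp add: add_pos_pos)
  then have l: "l > sqrt B" using pos by (simp add: real_less_lsqrt)
  have "a * sqrt B * B \<le> a * l * (2 * (B - c * h))"
    using l h1 pos by (intro mult_mono) auto
  with h2 have "c\<^sup>2 * h < a * l * (B - c * h)" by linarith
  then have "h * (c\<^sup>2 * h) < h * (a * l * (B - c * h))"
    using pos by simp
  then have key: "(c * h)\<^sup>2 < a * h * l * (B - c * h)"
    by (simp add: power2_eq_square algebra_simps)
  have "(l * m)\<^sup>2 = (a * h * l + (B + c * h)) * (a * h * m + (B - c * h))"
    using assms by (simp add: power_mult_distrib)
  also have "\<dots> = (a * h)\<^sup>2 * (l * m) + a * h * l * (B - c * h) + a * h * m * (B + c * h)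
      + (B\<^sup>2 - (c * h)\<^sup>2)"
    by (simp add: power2_eq_square algebra_simps)
  also have "\<dots> > B\<^sup>2"
  proof -
    have "(a * h)\<^sup>2 * (l * m) > 0" "a * h * m * (B + c * h) > 0"
      using pos by (simp_all add: add_pos_pos)
    then show ?thesis using key by linarith
  qed
  finally show ?thesis using pos by (simp add: power2_less_imp_less)
qed

text \<open>Beyond its last zero before \<open>x0\<close>, \<open>p\<close> keeps its sign up to
  \<open>x0\<close>, so all even or all odd \<open>n\<close> work there.\<close>

lemma poly_eventually_parity:
  fixes p :: "real poly"
  assumes "p \<noteq> 0" and "y < x0"
  obtains M where "y \<le> M" "M < x0"
    "\<And>N. \<exists>n\<ge>N. \<forall>x. M < x \<longrightarrow> x < x0 \<longrightarrow> (- 1) ^ n * poly p x < 0"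
proof
  let ?S = "insert y {x. poly p x = 0 \<and> x < x0}"
  have fin: "finite ?S" using poly_roots_finite[OF assms(1)] by simp
  define M where "M = Max ?S"
  show "y \<le> M" using fin by (simp add: M_def)
  have "M \<in> ?S" unfolding M_def using fin by (intro Max_in) auto
  then show "M < x0" using assms(2) by auto
  have nz: "poly p x \<noteq> 0" if "M < x" "x < x0" for x
    using that Max_ge[OF fin, of x] by (auto simp: M_def)
  obtain x1 where x1: "M < x1" "x1 < x0" using dense[OF \<open>M < x0\<close>] by blast
  have same: "poly p x1 * poly p x > 0" if "M < x" "x < x0" for x
  proof (rule ccontr)
    assume "\<not> ?thesis"
    then have neg: "poly p x1 * poly p x < 0"
      using nz[OF x1] nz[OF that] by (simp add: less_le not_less)
    then consider "x1 < x" | "x < x1"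
      by (metis linorder_cases not_square_less_zero)
    then show False
    proof cases
      case 1
      then show False using poly_IVT[OF 1 neg] nz x1 that by (meson less_trans)
    next
      case 2
      then show False using poly_IVT[OF 2] neg nz x1 that by (metis less_trans mult.commute)
    qed
  qed
  fix N :: nat
  obtain n where "N \<le> n" and n: "(- 1) ^ n * poly p x1 < 0"
  proof (cases "(- 1) ^ N * poly p x1 < 0")
    case False
    moreover have "(- 1) ^ N * poly p x1 \<noteq> 0" using nz[OF x1] by simp
    ultimately have "(- 1) ^ N * poly p x1 > 0" by linarith
    then have "(- 1) ^ Suc N * poly p x1 < 0" by simp
    then show thesis by (intro that[of "Suc N"]) auto
  qed (use that in auto)
  have "(- 1) ^ n * poly p x < 0" if "M < x" "x < x0" for x
  proof -
    have "((- 1) ^ n * poly p x1) * (poly p x1 * poly p x) < 0"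
      using n same[OF that] by (rule mult_neg_pos)
    then have "(poly p x1)\<^sup>2 * ((- 1) ^ n * poly p x) < 0"
      by (simp add: power2_eq_square mult_ac)
    then show ?thesis by (simp add: mult_less_0_iff)
  qed
  then show "\<exists>n\<ge>N. \<forall>x. M < x \<longrightarrow> x < x0 \<longrightarrow> (- 1) ^ n * poly p x < 0"
    using \<open>N \<le> n\<close> by blast
qed

lemma not_all_real_rooted_W:
  fixes a b c d :: real
  assumes "a > 0" "c > 0" "b < 0" "d < 0" and gt: "- b / a > - d / c"
  shows "\<exists>n. \<not> real_rooted (W a b c d n)"
proof (rule ccontr)
  assume "\<not> ?thesis"
  then have rr: "real_rooted (W a b c d n)" for n by blast
  define x0 where "x0 = - b / a"
  define B where "B = c * x0 + d"
  have B_pos: "c * x + d > 0" if "x > - d / c" for x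
    using that \<open>c > 0\<close> by (simp add: field_simps)
  have B: "B > 0" unfolding B_def using gt by (intro B_pos) (simp add: x0_def)
  have A0: "a * x0 + b = 0" using \<open>a > 0\<close> by (simp add: x0_def)
  have y_pos: "- d / c > 0" using assms by (simp add: field_simps)
  \<comment> \<open>the characteristic polynomial \<open>\<lambda>\<^sup>2 - (a x + b) \<lambda> - (c x + d)\<close> at \<open>\<lambda> = x\<close>; its sign decides which
    parity of \<open>n\<close> makes both terms of Binet's formula positive\<close>
  define \<chi> where "\<chi> = [:- d, - (b + c), 1 - a:]"
  have "\<chi> \<noteq> 0" using \<open>d < 0\<close> by (simp add: \<chi>_def)
  have \<chi>: "poly \<chi> x = x\<^sup>2 - (a * x + b) * x - (c * x + d)" for x
    by (simp add: \<chi>_def power2_eq_square algebra_simps)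
  obtain M where M: "- d / c \<le> M" "M < x0" and
    par: "\<And>N. \<exists>n\<ge>N. \<forall>x. M < x \<longrightarrow> x < x0 \<longrightarrow> (- 1) ^ n * poly \<chi> x < 0"
    using poly_eventually_parity[OF \<open>\<chi> \<noteq> 0\<close>] gt unfolding x0_def by blast
  \<comment> \<open>The three bounds keep \<open>x0 - h\<close> to the right of \<open>M\<close> and
    give \<open>h1\<close> and \<open>h2\<close>; the 4 makes \<open>h2\<close> strict.\<close>
  define h where "h = min ((x0 - M) / 2) (min (B / (2 * c)) (a * sqrt B * B / (4 * c\<^sup>2)))"
  have aB: "a * sqrt B * B > 0" using B assms by simp
  have h: "h > 0" "h \<le> (x0 - M) / 2" "h \<le> B / (2 * c)" "h \<le> a * sqrt B * B / (4 * c\<^sup>2)"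
    using M B aB \<open>c > 0\<close> unfolding h_def by (simp_all only: min_less_iff_conj) auto
  have h1: "2 * (c * h) \<le> B" using h(3) \<open>c > 0\<close> by (simp add: field_simps)
  have "4 * c\<^sup>2 * h \<le> a * sqrt B * B" using h(4) \<open>c > 0\<close> by (simp add: field_simps)
  then have h2: "2 * c\<^sup>2 * h < a * sqrt B * B" using aB by linarith
  define u where "u = x0 - h"
  define v where "v = x0 + h"
  have u: "M < u" "u < x0" using h M by (auto simp: u_def)
  have Au: "a * u + b = - (a * h)" and Av: "a * v + b = a * h"
    using A0 by (simp_all add: u_def v_def algebra_simps)
  have Bu: "c * u + d = B - c * h" and Bv: "c * v + d = B + c * h"
    by (simp_all add: u_def v_def B_def algebra_simps)
  \<comment> \<open>The linear coefficient is negative at \<open>u\<close> and positive at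
    \<open>v\<close>, so the dominant moduli are \<open>m\<close> and \<open>l\<close>; the primed
    roots are the smaller ones.\<close>
  have ubig: "u > - d / c" using u M by linarith
  obtain l' m where lm': "l' > 0" "m > 0" "l' - m = a * u + b" "l' * m = c * u + d"
    using char_roots_exist[OF B_pos[OF ubig]] by blast
  obtain l m' where lm: "l > 0" "m' > 0" "l - m' = a * v + b" "l * m' = c * v + d"
    using char_roots_exist[OF B_pos[of v]] ubig u h by (auto simp: v_def)
  have m2: "m\<^sup>2 = a * h * m + (B - c * h)"
  proof -
    have "m\<^sup>2 = l' * m - (l' - m) * m" by (simp add: power2_eq_square algebra_simps)
    then show ?thesis unfolding lm'(3,4) Au Bu by simp
  qed
  have l2: "l\<^sup>2 = a * h * l + (B + c * h)"
  proof -
    have "l\<^sup>2 = (l - m') * l + l * m'" by (simp add: power2_eq_square algebra_simps)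
    then show ?thesis unfolding lm(3,4) Av Bv by simp
  qed
  have gr: "l * m > B"
    using char_root_product[OF m2 l2] assms h B lm lm' h1 h2 by blast

  define K1 where "K1 = \<bar>u - l'\<bar> / (l' + m)"
  define K2 where "K2 = min 1 (v / l)"
  define K3 where "K3 = 1 + x0\<^sup>2 / B"
  have v_pos: "v > 0" using y_pos ubig u h by (auto simp: v_def)
  have K2: "K2 > 0" "K2 \<le> 1" "K2 * l \<le> v"
    using v_pos lm(1) by (auto simp: K2_def min_def divide_simps)
  have K3: "K3 \<ge> 1" using B by (simp add: K3_def)
  \<comment> \<open>Parity is needed only to the left of \<open>x0\<close>; from \<open>x0\<close>
    on, both coefficients are nonnegative and every \<open>n\<close> works.\<close>
  have W_pos: "poly (W a b c d n) x > 0"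
    if n: "\<forall>x. M < x \<longrightarrow> x < x0 \<longrightarrow> (- 1) ^ n * poly \<chi> x < 0" and x: "M < x" for n x
  proof -
    have big: "x > - d / c" using x M by linarith
    then have x_pos: "x > 0" using y_pos by linarith
    obtain l m where lm: "l > 0" "m > 0" "l - m = a * x + b" "l * m = c * x + d"
      using char_roots_exist[OF B_pos[OF big]] by blast
    show ?thesis
    proof (cases "x < x0")
      case True
      then show ?thesis
        using W_lower_parity(2)[OF lm(3,4,1,2) x_pos] n x unfolding \<chi> by blast
    next
      case False
      then have "a * (x - x0) \<ge> 0" using \<open>a > 0\<close> by simp
      then have "a * x + b \<ge> 0" using A0 by (simp add: algebra_simps)
      moreover have "l\<^sup>2 = (a * x + b) * l + (c * x + d)"
        unfolding lm(3,4)[symmetric] by (simp add: power2_eq_square algebra_simps)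
      moreover have "min 1 (x / l) * l \<le> x"
        using x_pos lm(1) by (auto simp: min_def divide_simps)
      ultimately have "min 1 (x / l) * l ^ n \<le> poly (W a b c d n) x"
        using B_pos[OF big] lm(1) by (intro W_lower_pos) auto
      moreover have "min 1 (x / l) * l ^ n > 0" using lm x_pos by simp
      ultimately show ?thesis by linarith
    qed
  qed
  have bound: "K1 > 0 \<and> K1 * K2 * (l * m / B) ^ n \<le> K3"
    if n: "\<forall>x. M < x \<longrightarrow> x < x0 \<longrightarrow> (- 1) ^ n * poly \<chi> x < 0" for n
  proof -
    let ?w = "poly (W a b c d n)"
    have "(- 1) ^ n * (u\<^sup>2 - (a * u + b) * u - (c * u + d)) < 0"
      using n u unfolding \<chi> by blast
    note low = W_lower_parity[OF lm'(3,4,1,2) _ this]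
    have u_pos: "u > 0" using y_pos ubig by linarith
    have "K1 > 0" using low(3)[OF u_pos] lm' by (simp add: K1_def)
    have 1: "K1 * m ^ n \<le> ?w u"
      using low(1)[OF u_pos] lm' by (simp add: K1_def field_simps)
    have 2: "K2 * l ^ n \<le> ?w v"
    proof (rule W_lower_pos)
      show "l\<^sup>2 = (a * v + b) * l + (c * v + d)" using l2 Av Bv by simp
    qed (use Av Bv assms h B lm K2 in auto)
    have "?w x \<noteq> 0" if "x0 - h \<le> x" for x
      using W_pos[OF n, of x] u that by (auto simp: u_def)
    then have "\<bar>?w u * ?w v\<bar> \<le> (?w x0)\<^sup>2"
      unfolding u_def v_def using h by (intro real_rooted_midpoint rr) auto
    also have "\<dots> \<le> K3 * B ^ n"
      unfolding K3_def B_def using A0 B by (intro W_square_at_zero) (auto simp: B_def)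
    finally have "?w u * ?w v \<le> K3 * B ^ n" by linarith
    moreover have "(K1 * m ^ n) * (K2 * l ^ n) \<le> ?w u * ?w v"
      using 1 2 W_pos[OF n, of u] u K2 lm by (intro mult_mono) auto
    ultimately have "K1 * K2 * (l * m) ^ n \<le> K3 * B ^ n"
      by (simp add: power_mult_distrib mult_ac)
    then have "K1 * K2 * (l * m / B) ^ n \<le> K3"
      using B by (simp add: power_divide field_simps)
    with \<open>K1 > 0\<close> show ?thesis by blast
  qed
  \<comment> \<open>\<open>K1\<close> does not depend on \<open>n\<close>, so a single index of the
    right parity suffices.\<close>
  have K1: "K1 > 0" using par[of 0] bound by blast
  have q: "l * m / B > 1" using gr B by simp
  obtain N where N: "K3 / (K1 * K2) < (l * m / B) ^ N"
    using real_arch_pow[OF q] by blast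
  obtain n where "n \<ge> N" and n: "\<forall>x. M < x \<longrightarrow> x < x0 \<longrightarrow> (- 1) ^ n * poly \<chi> x < 0"
    using par by blast
  have "(l * m / B) ^ N \<le> (l * m / B) ^ n"
    using \<open>n \<ge> N\<close> q by (intro power_increasing) auto
  with N have "K3 / (K1 * K2) < (l * m / B) ^ n" by linarith
  then have "K3 < K1 * K2 * (l * m / B) ^ n"
    using K1 K2 by (simp add: pos_divide_less_eq mult_ac)
  with bound[OF n] show False by linarith
qed

theorem theorem3p1:
  fixes a b c d :: real
  assumes "a > 0" and "c > 0" and "b < 0" and "d < 0"
  shows "(\<forall>n. real_rooted (W a b c d n)) \<longleftrightarrow> - b / a \<le> - d / c"
proof
  assume "\<forall>n. real_rooted (W a b c d n)"
  then show "- b / a \<le> - d / c"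
    using not_all_real_rooted_W[OF assms] by (meson not_le)
next
  assume "- b / a \<le> - d / c"
  then have "a * d \<le> b * c" using assms by (simp add: field_simps)
  then show "\<forall>n. real_rooted (W a b c d n)" using assms real_rooted_W by blast
qed

end
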